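(* Suppose that a group $G$ is the directed union of subgroups $G_j$ (that is, $(G_j)_j$ is a non-empty family of subgroups of $G$, directed under inclusion, with $\bigcup_j G_j=G$), each of which has property $\mathrm{PHP}$. Then $G$ has property $\mathrm{PHP}$.
   Context: Property $\mathrm{PHP}$ (Ozawa): a group $G$ has property $\mathrm{PHP}$ if for every finite $F\subseteq G$ and every $\varepsilon>0$ there exists $N\geq 1$ such that for all integers $n\geq N$ there are elements $t_1,\ldots,t_n\in G$ and subsets $C_i\subseteq D_i\subseteq G$ ($1\leq i\leq n$) such that: (1) the sets $aC_i$ ($a\in F$, $1\leq i\leq n$) together with the sets $at_i^{-1}(G\setminus D_i)$ ($a\in F$, $1\leq i\leq n$) are pairwise disjoint, as an indexed family (i.e. members with different type or different index $(a,i)$ are disjoint); (2) for every $x\in G$, the set $J(x):=\{i: x\in D_i\}\cup\{i: x\in t_i^{-1}(G\setminus C_i)\}$ has cardinality at most $\varepsilon\sqrt{n}$. *)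

theory Defs
  imports Complex_Main "HOL-Algebra.Coset" "HOL-Library.Disjoint_Sets"
begin

text \<open>
  The translates occurring in condition (1) of property PHP, as one family indexed by a
  disjoint sum: the index \<open>Inl (a, i)\<close> stands for \<open>a C\<^sub>i\<close> and
  \<open>Inr (a, i)\<close> for \<open>a t\<^sub>i\<^sup>-\<^sup>1 (G - D\<^sub>i)\<close>.
\<close>

definition PHP_translates ::
  "('a, 'b) monoid_scheme \<Rightarrow> (nat \<Rightarrow> 'a) \<Rightarrow> (nat \<Rightarrow> 'a set) \<Rightarrow> (nat \<Rightarrow> 'a set) \<Rightarrow>
    ('a \<times> nat) + ('a \<times> nat) \<Rightarrow> 'a set" where
  "PHP_translates G t C D k =
    (case k of
      Inl (a, i) \<Rightarrow> a <#\<^bsub>G\<^esub> C i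
    | Inr (a, i) \<Rightarrow> (a \<otimes>\<^bsub>G\<^esub> inv\<^bsub>G\<^esub> t i) <#\<^bsub>G\<^esub> (carrier G - D i))"

definition PHP_indices ::
  "('a, 'b) monoid_scheme \<Rightarrow> nat \<Rightarrow> (nat \<Rightarrow> 'a) \<Rightarrow> (nat \<Rightarrow> 'a set) \<Rightarrow> (nat \<Rightarrow> 'a set) \<Rightarrow>
    'a \<Rightarrow> nat set" where
  "PHP_indices G n t C D x =
    {i \<in> {1..n}. x \<in> D i} \<union>
    {i \<in> {1..n}. x \<in> inv\<^bsub>G\<^esub> t i <#\<^bsub>G\<^esub> (carrier G - C i)}"

definition PHP :: "('a, 'b) monoid_scheme \<Rightarrow> bool" where
  "PHP G \<longleftrightarrow>
    (\<forall>F \<epsilon>. finite F \<and> F \<subseteq> carrier G \<and> (0::real) < \<epsilon> \<longrightarrow>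
      (\<exists>N\<ge>1. \<forall>n\<ge>N. \<exists>t C D.
        (\<forall>i\<in>{1..n}. t i \<in> carrier G \<and> C i \<subseteq> D i \<and> D i \<subseteq> carrier G) \<and>
        disjoint_family_on (PHP_translates G t C D) ((F \<times> {1..n}) <+> (F \<times> {1..n})) \<and>
        (\<forall>x\<in>carrier G. real (card (PHP_indices G n t C D x)) \<le> \<epsilon> * sqrt (real n))))"

end

theory Submission
  imports Defs
begin

text \<open>
  A finite subset of \<open>G\<close> lies in a single member \<open>K\<close> of the directed family, so it suffices to
  move a witness from \<open>K\<close> to \<open>G\<close>. Choosing representatives of the right cosets of \<open>K\<close> gives a left
  \<open>K\<close>-equivariant map \<open>p : G \<rightarrow> K\<close>. Taking preimages under \<open>p\<close> commutes with complements and with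
  left translation by elements of \<open>K\<close>, hence it preserves disjointness, and the index set of \<open>x\<close>
  for the preimages is the index set of \<open>p x\<close> for the original sets.
\<close>

lemma directed_finite_subset:
  assumes "finite F" and "J \<noteq> {}" and "F \<subseteq> (\<Union>j\<in>J. H j)"
    and dir: "\<And>i j. i \<in> J \<Longrightarrow> j \<in> J \<Longrightarrow> \<exists>k\<in>J. H i \<subseteq> H k \<and> H j \<subseteq> H k"
  shows "\<exists>k\<in>J. F \<subseteq> H k"
  using assms(1,3)
proof (induction F rule: finite_induct)
  case empty
  then show ?case using \<open>J \<noteq> {}\<close> by blast
next
  case (insert x F)
  then obtain i j where "i \<in> J" "F \<subseteq> H i" "j \<in> J" "x \<in> H j"
    by blast
  then show ?case
    using dir[of i j] by blast
qed

text \<open>Each right coset of \<open>K\<close> is a copy of \<open>K\<close> on which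
  \<open>K\<close> acts by left multiplication; \<open>p x\<close> is the
  \<open>K\<close>-coordinate of \<open>x\<close> relative to the representative \<open>r x\<close>
  of its coset, so that \<open>x = p x \<otimes> r x\<close>. Since the representative of
  \<open>K\<close> itself need not be the identity, \<open>p\<close> need not fix \<open>K\<close>
  pointwise.\<close>

lemma (in group) equivariant_retraction:
  assumes "subgroup K G"
  obtains p where "p \<in> carrier G \<rightarrow> K"
    and "\<forall>h\<in>K. \<forall>x\<in>carrier G. p (h \<otimes> x) = h \<otimes> p x"
proof
  interpret K: subgroup K G by fact
  \<comment> \<open>The choice depends on \<open>x\<close> only through the set
    \<open>K #> x\<close>, so \<open>r\<close> is constant on right cosets. This is what makes
    \<open>p\<close> equivariant.\<close>
  define r where "r x = (SOME y. y \<in> K #> x)" for x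
  have r: "r x \<in> K #> x" if "x \<in> carrier G" for x
    unfolding r_def using rcos_self[OF that assms] by (rule someI)
  have r_carrier: "r x \<in> carrier G" if "x \<in> carrier G" for x
    using r[OF that] that r_coset_subset_G[OF K.subset] by blast
  show "(\<lambda>x. x \<otimes> inv (r x)) \<in> carrier G \<rightarrow> K"
  proof
    fix x assume x: "x \<in> carrier G"
    \<comment> \<open>With \<open>r x = k \<otimes> x\<close>, the product
      \<open>x \<otimes> inv (r x)\<close> collapses to \<open>inv k\<close>.\<close>
    then obtain k where k: "k \<in> K" "r x = k \<otimes> x"
      using r unfolding r_coset_def by blast
    then show "x \<otimes> inv (r x) \<in> K"
      using x by (simp add: inv_mult_group flip: m_assoc)
  qed
  show "\<forall>h\<in>K. \<forall>x\<in>carrier G. h \<otimes> x \<otimes> inv (r (h \<otimes> x)) = h \<otimes> (x \<otimes> inv (r x))"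
  proof (intro ballI)
    fix h x assume h: "h \<in> K" and x: "x \<in> carrier G"
    have "K #> (h \<otimes> x) = K #> x"
      using coset_mult_assoc[OF K.subset, of h x] coset_join2[OF _ assms h] h x by simp
    then show "h \<otimes> x \<otimes> inv (r (h \<otimes> x)) = h \<otimes> (x \<otimes> inv (r x))"
      using h x r_carrier by (simp add: r_def m_assoc)
  qed
qed

text \<open>For \<open>a\<close> in \<open>K\<close>, equivariance under \<open>inv a\<close> shows
  that \<open>p y\<close> lies in \<open>a <# C\<close> exactly when
  \<open>p (inv a \<otimes> y)\<close> lies in \<open>C\<close>.\<close>

lemma (in group) l_coset_equivariant_preimage:
  assumes "subgroup K G" and p: "p \<in> carrier G \<rightarrow> K"
    and equiv: "\<And>h x. h \<in> K \<Longrightarrow> x \<in> carrier G \<Longrightarrow> p (h \<otimes> x) = h \<otimes> p x"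
    and a: "a \<in> K" and C: "C \<subseteq> K"
  shows "a <# {x \<in> carrier G. p x \<in> C} = {x \<in> carrier G. p x \<in> a <# C}"
proof (intro equalityI subsetI)
  interpret K: subgroup K G by fact
  fix y
  show "y \<in> {x \<in> carrier G. p x \<in> a <# C}" if "y \<in> a <# {x \<in> carrier G. p x \<in> C}"
    using that a by (auto simp: l_coset_def equiv)
  assume "y \<in> {x \<in> carrier G. p x \<in> a <# C}"
  then obtain c where y: "y \<in> carrier G" and c: "c \<in> C" "p y = a \<otimes> c"
    by (auto simp: l_coset_def)
  have "p (inv a \<otimes> y) = c"
    using a c y C by (simp add: equiv subset_eq flip: m_assoc)
  then have "inv a \<otimes> y \<in> {x \<in> carrier G. p x \<in> C}"
    using a y c by simp
  moreover have "y = a \<otimes> (inv a \<otimes> y)"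
    using a y by (simp flip: m_assoc)
  ultimately show "y \<in> a <# {x \<in> carrier G. p x \<in> C}"
    unfolding l_coset_def by blast
qed

lemma l_coset_carrier_update [simp]: "a <#\<^bsub>G\<lparr>carrier := K\<rparr>\<^esub> C = a <#\<^bsub>G\<^esub> C"
  by (simp add: l_coset_def)

text \<open>The elements \<open>t i\<close> are kept and only the sets are pulled back. All
  translating elements \<open>a\<close>, \<open>a \<otimes> inv (t i)\<close> and
  \<open>inv (t i)\<close> lie in \<open>K\<close>, so equivariance applies to each of them.\<close>

lemma (in group)
  assumes K: "subgroup K G" and p: "p \<in> carrier G \<rightarrow> K"
    and equiv: "\<forall>h\<in>K. \<forall>x\<in>carrier G. p (h \<otimes> x) = h \<otimes> p x"
    and tCD: "\<forall>i\<in>{1..n}. t i \<in> K \<and> C i \<subseteq> D i \<and> D i \<subseteq> K"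
  defines "C' \<equiv> \<lambda>i. {x \<in> carrier G. p x \<in> C i}" and "D' \<equiv> \<lambda>i. {x \<in> carrier G. p x \<in> D i}"
  shows PHP_translates_preimage:
      "F \<subseteq> K \<Longrightarrow> k \<in> (F \<times> {1..n}) <+> (F \<times> {1..n}) \<Longrightarrow>
        PHP_translates G t C' D' k =
        {x \<in> carrier G. p x \<in> PHP_translates (G\<lparr>carrier := K\<rparr>) t C D k}"
    and PHP_indices_preimage:
      "x \<in> carrier G \<Longrightarrow>
        PHP_indices G n t C' D' x = PHP_indices (G\<lparr>carrier := K\<rparr>) n t C D (p x)"
proof -
  interpret K: subgroup K G by fact
  \<comment> \<open>As \<open>p\<close> takes values in \<open>K\<close>, complements in
    \<open>G\<close> pull back from complements in \<open>K\<close>, the ones used by PHP of the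
    subgroup.\<close>
  have compl: "carrier G - {x \<in> carrier G. p x \<in> A} = {x \<in> carrier G. p x \<in> K - A}" for A
    using p by auto
  note coset = l_coset_equivariant_preimage[OF K p equiv[rule_format]]
  have t: "t i \<in> K" if "i \<in> {1..n}" for i
    using tCD that by blast
  have coset_compl: "a <# (carrier G - {x \<in> carrier G. p x \<in> A}) =
      {x \<in> carrier G. p x \<in> a <# (K - A)}" if "a \<in> K" for a A
    unfolding compl using that by (intro coset) auto
  \<comment> \<open>PHP of the subgroup takes inverses in the restricted structure; they agree with
    those of \<open>G\<close>.\<close>
  note inv = m_inv_consistent[OF K]
  show "PHP_translates G t C' D' k =
      {x \<in> carrier G. p x \<in> PHP_translates (G\<lparr>carrier := K\<rparr>) t C D k}"
    if F: "F \<subseteq> K" and k: "k \<in> (F \<times> {1..n}) <+> (F \<times> {1..n})"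
    using k
  proof
    fix q assume "k = Inl q" "q \<in> F \<times> {1..n}"
    then obtain a i where k: "k = Inl (a, i)" and a: "a \<in> K" and i: "i \<in> {1..n}"
      using F by auto
    have "C i \<subseteq> K" using tCD i by blast
    then show ?thesis
      using a by (simp add: k PHP_translates_def C'_def coset)
  next
    fix q assume "k = Inr q" "q \<in> F \<times> {1..n}"
    then obtain a i where k: "k = Inr (a, i)" and a: "a \<in> K" and i: "i \<in> {1..n}"
      using F by auto
    show ?thesis
      using a t[OF i] by (simp add: k PHP_translates_def D'_def coset_compl inv)
  qed
  show "PHP_indices G n t C' D' x = PHP_indices (G\<lparr>carrier := K\<rparr>) n t C D (p x)"
    if x: "x \<in> carrier G"
  proof -
    have "inv t i <# (carrier G - C' i) = {x \<in> carrier G. p x \<in> inv t i <# (K - C i)}"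
      if "i \<in> {1..n}" for i
      using t[OF that] by (simp add: C'_def coset_compl)
    then show ?thesis
      using x t by (auto simp: PHP_indices_def D'_def inv)
  qed
qed

theorem lemma2p2:
  fixes G :: "('a, 'b) monoid_scheme" and J :: "'j set" and H :: "'j \<Rightarrow> 'a set"
  assumes "group G"
    and "J \<noteq> {}"
    and "\<And>j. j \<in> J \<Longrightarrow> subgroup (H j) G"
    and "\<And>i j. i \<in> J \<Longrightarrow> j \<in> J \<Longrightarrow> \<exists>k\<in>J. H i \<subseteq> H k \<and> H j \<subseteq> H k"
    and "(\<Union>j\<in>J. H j) = carrier G"
    and "\<And>j. j \<in> J \<Longrightarrow> PHP (G\<lparr>carrier := H j\<rparr>)"
  shows "PHP G"
  unfolding PHP_def
proof (intro allI impI)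
  interpret group G by fact
  fix F and \<epsilon> :: real
  assume F\<epsilon>: "finite F \<and> F \<subseteq> carrier G \<and> 0 < \<epsilon>"
  then obtain j where j: "j \<in> J" and F: "F \<subseteq> H j"
    using directed_finite_subset[of F J H] assms(2,4,5) by auto
  note K = assms(3)[OF j]
  interpret K: subgroup "H j" G by (fact K)
  let ?K = "G\<lparr>carrier := H j\<rparr>"
  obtain p where p: "p \<in> carrier G \<rightarrow> H j"
    and equiv: "\<forall>h\<in>H j. \<forall>x\<in>carrier G. p (h \<otimes>\<^bsub>G\<^esub> x) = h \<otimes>\<^bsub>G\<^esub> p x"
    by (rule equivariant_retraction[OF K])
  \<comment> \<open>The threshold for \<open>H j\<close>, with the same \<open>F\<close> and
    \<open>\<epsilon>\<close>, also serves for \<open>G\<close>.\<close>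
  obtain N where "N \<ge> 1" and N: "\<forall>n\<ge>N. \<exists>t C D.
      (\<forall>i\<in>{1..n}. t i \<in> H j \<and> C i \<subseteq> D i \<and> D i \<subseteq> H j) \<and>
      disjoint_family_on (PHP_translates ?K t C D) ((F \<times> {1..n}) <+> (F \<times> {1..n})) \<and>
      (\<forall>x\<in>H j. real (card (PHP_indices ?K n t C D x)) \<le> \<epsilon> * sqrt (real n))"
    using assms(6)[OF j, unfolded PHP_def, rule_format, of F \<epsilon>] F F\<epsilon> by auto
  show "\<exists>N\<ge>1. \<forall>n\<ge>N. \<exists>t C D.
      (\<forall>i\<in>{1..n}. t i \<in> carrier G \<and> C i \<subseteq> D i \<and> D i \<subseteq> carrier G) \<and>
      disjoint_family_on (PHP_translates G t C D) ((F \<times> {1..n}) <+> (F \<times> {1..n})) \<and>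
      (\<forall>x\<in>carrier G. real (card (PHP_indices G n t C D x)) \<le> \<epsilon> * sqrt (real n))"
  proof (intro exI[of _ N] conjI allI impI \<open>N \<ge> 1\<close>)
    fix n assume "n \<ge> N"
    then obtain t C D
      where tCD: "\<forall>i\<in>{1..n}. t i \<in> H j \<and> C i \<subseteq> D i \<and> D i \<subseteq> H j"
        and disj: "disjoint_family_on (PHP_translates ?K t C D) ((F \<times> {1..n}) <+> (F \<times> {1..n}))"
        and card: "\<forall>x\<in>H j. real (card (PHP_indices ?K n t C D x)) \<le> \<epsilon> * sqrt (real n)"
      using N by blast
    note translates = PHP_translates_preimage[OF K p equiv tCD F]
    note indices = PHP_indices_preimage[OF K p equiv tCD]
    let ?C = "\<lambda>i. {x \<in> carrier G. p x \<in> C i}" and ?D = "\<lambda>i. {x \<in> carrier G. p x \<in> D i}"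
    show "\<exists>t C D.
        (\<forall>i\<in>{1..n}. t i \<in> carrier G \<and> C i \<subseteq> D i \<and> D i \<subseteq> carrier G) \<and>
        disjoint_family_on (PHP_translates G t C D) ((F \<times> {1..n}) <+> (F \<times> {1..n})) \<and>
        (\<forall>x\<in>carrier G. real (card (PHP_indices G n t C D x)) \<le> \<epsilon> * sqrt (real n))"
    proof (intro exI conjI)
      show "\<forall>i\<in>{1..n}. t i \<in> carrier G \<and> ?C i \<subseteq> ?D i \<and> ?D i \<subseteq> carrier G"
        using tCD K.subset by auto
      show
        "disjoint_family_on (PHP_translates G t ?C ?D) ((F \<times> {1..n}) <+> (F \<times> {1..n}))"
        unfolding disjoint_family_on_def
      proof (intro ballI impI)
        fix k l assume kl: "k \<in> (F \<times> {1..n}) <+> (F \<times> {1..n})"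
          "l \<in> (F \<times> {1..n}) <+> (F \<times> {1..n})" "k \<noteq> l"
        \<comment> \<open>Both translates are preimages under \<open>p\<close> of members of the
          disjoint family in \<open>H j\<close>.\<close>
        show "PHP_translates G t ?C ?D k \<inter> PHP_translates G t ?C ?D l = {}"
          unfolding translates[OF kl(1)] translates[OF kl(2)]
          using disjoint_family_onD[OF disj kl] by blast
      qed
      \<comment> \<open>The bound at \<open>x\<close> is the bound in \<open>H j\<close> at the
        point \<open>p x\<close>.\<close>
      show
        "\<forall>x\<in>carrier G. real (card (PHP_indices G n t ?C ?D x)) \<le> \<epsilon> * sqrt (real n)"
        using card p by (auto simp: indices)
    qed
  qed
qed

end
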